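(* Let $\mathbb F$ be a field of characteristic not $2$. If $n$ is odd, then $\Xi_n(\mathbb F)$ is empty. Moreover, a $2\times 2$ matrix $M$ over $\mathbb F$ belongs to $\Xi_2(\mathbb F)$ if and only if $M$ is not symmetric.
   Context: For a field $\mathbb F$ and a positive integer $n$, $\Xi_n(\mathbb F)$ denotes the set of all $n\times n$ matrices $M$ over $\mathbb F$ such that every nonsingular $n\times n$ matrix $S$ over $\mathbb F$ with $S^TMS=M$ satisfies $\det S=1$. *)

theory Defs
  imports "Jordan_Normal_Form.Determinant"
begin

text \<open>The field is the element type; \<open>n\<close> is meant to be positive.\<close>

definition Xi :: "nat \<Rightarrow> 'a::field mat set" where
  "Xi n = {M \<in> carrier_mat n n.
     \<forall>S \<in> carrier_mat n n. invertible_mat S \<and> transpose_mat S * M * S = M \<longrightarrow> det S = 1}"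

definition symmetric_mat :: "'a mat \<Rightarrow> bool" where
  "symmetric_mat M \<longleftrightarrow> transpose_mat M = M"

end

theory Submission
  imports Defs
begin

text \<open>
  For odd \<open>n\<close> the matrix \<open>- I\<close> preserves every form and has determinant \<open>-1 \<noteq> 1\<close>, so
  \<open>\<Xi>\<^sub>n\<close> is empty.

  For \<open>n = 2\<close>, the skew part \<open>M - M\<^sup>T\<close> is a multiple of the standard symplectic matrix, and a
  substitution \<open>S\<close> multiplies the latter by \<open>det S\<close>. A nonzero skew part that is preserved
  therefore forces \<open>det S = 1\<close>. If the skew part vanishes, \<open>M\<close> is the Gram matrix of a symmetric
  bilinear form, and such a form on the plane is preserved by a reflection: along a basis
  vector that is not isotropic, or, when both basis vectors are isotropic, by exchanging the two.
  A reflection has determinant \<open>-1\<close>.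
\<close>

lemma minus_one_neq_one:
  assumes "CHAR('a::field) \<noteq> 2"
  shows "(- 1 :: 'a) \<noteq> 1"
proof
  assume "(- 1 :: 'a) = 1"
  then have "(of_nat 2 :: 'a) = 0"
    by (metis add.right_inverse of_nat_numeral one_add_one)
  then have "CHAR('a) dvd 2"
    by (simp only: of_nat_eq_0_iff_char_dvd)
  then have "CHAR('a) = 1 \<or> CHAR('a) = 2"
    by (metis prime_nat_iff two_is_prime_nat)
  then show False
    using assms by simp
qed

lemma invertible_mat_if_det_nonzero:
  fixes S :: "'a::field mat"
  assumes S: "S \<in> carrier_mat n n" and "det S \<noteq> 0"
  shows "invertible_mat S"
proof -
  have "S \<in> Units (ring_mat TYPE('a) n ())"
    using assms by (rule det_non_zero_imp_unit)
  then obtain B where "B \<in> carrier_mat n n" "B * S = 1\<^sub>m n" "S * B = 1\<^sub>m n"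
    unfolding Units_def ring_mat_def by auto
  then show ?thesis
    using S unfolding invertible_mat_def inverts_mat_def by auto
qed

lemma not_in_XiI:
  fixes M S :: "'a::field mat"
  assumes S: "S \<in> carrier_mat n n"
    and pres: "transpose_mat S * M * S = M"
    and det: "det S = - 1"
    and char: "CHAR('a) \<noteq> 2"
  shows "M \<notin> Xi n"
proof -
  have "invertible_mat S"
    using S det by (simp add: invertible_mat_if_det_nonzero)
  then show ?thesis
    using S pres det minus_one_neq_one[OF char] unfolding Xi_def by auto
qed

lemma Xi_odd_empty:
  assumes char: "CHAR('a::field) \<noteq> 2" and "odd n"
  shows "(Xi n :: 'a mat set) = {}"
proof -
  have "M \<notin> Xi n" if M: "M \<in> carrier_mat n n" for M :: "'a mat"
  proof (rule not_in_XiI[OF _ _ _ char])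
    show "- 1\<^sub>m n \<in> carrier_mat n n"
      by simp
    have "transpose_mat (- 1\<^sub>m n :: 'a mat) = - 1\<^sub>m n"
      by (auto intro!: eq_matI)
    then show "transpose_mat (- 1\<^sub>m n) * M * (- 1\<^sub>m n) = M"
      using M by simp
    have "(- 1\<^sub>m n :: 'a mat) = (- 1) \<cdot>\<^sub>m 1\<^sub>m n"
      by (auto intro!: eq_matI)
    then show "det (- 1\<^sub>m n :: 'a mat) = - 1"
      using \<open>odd n\<close> by (simp add: det_smult)
  qed
  then show ?thesis
    unfolding Xi_def by blast
qed

lemma mat2_eq_iff:
  assumes "A \<in> carrier_mat 2 2" "B \<in> carrier_mat 2 2"
  shows "A = B \<longleftrightarrow> A $$ (0,0) = B $$ (0,0) \<and> A $$ (0,1) = B $$ (0,1)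
    \<and> A $$ (1,0) = B $$ (1,0) \<and> A $$ (1,1) = B $$ (1,1)"
  using assms by (auto intro!: eq_matI simp: less_2_cases_iff)

lemma det_mat2:
  assumes "(S :: 'a::comm_ring_1 mat) \<in> carrier_mat 2 2"
  shows "det S = S $$ (0,0) * S $$ (1,1) - S $$ (0,1) * S $$ (1,0)"
proof -
  have "det S = S $$ (0,0) * cofactor S 0 0 + S $$ (0,1) * cofactor S 0 1"
    using laplace_expansion_row[OF assms, of 0] by (simp add: numeral_2_eq_2)
  moreover have "det (mat_delete S 0 j) = S $$ (1, 1 - j)" if "j < 2" for j
    using assms that by (subst det_single) (auto simp: mat_delete_def less_2_cases_iff)
  ultimately show ?thesis
    by (simp add: cofactor_def)
qed

lemma congruence_mat2_entry:
  fixes M S :: "'a::comm_ring_1 mat"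
  assumes "M \<in> carrier_mat 2 2" "S \<in> carrier_mat 2 2" "i < 2" "j < 2"
  shows "(transpose_mat S * M * S) $$ (i,j) =
      S $$ (0,i) * M $$ (0,0) * S $$ (0,j) + S $$ (0,i) * M $$ (0,1) * S $$ (1,j)
    + S $$ (1,i) * M $$ (1,0) * S $$ (0,j) + S $$ (1,i) * M $$ (1,1) * S $$ (1,j)"
  using assms by (simp add: scalar_prod_def numeral_2_eq_2 algebra_simps)

lemma symmetric_mat2_iff:
  assumes "M \<in> carrier_mat 2 2"
  shows "symmetric_mat M \<longleftrightarrow> M $$ (0,1) = M $$ (1,0)"
  using assms by (auto simp: symmetric_mat_def mat2_eq_iff)

text \<open>The space of alternating forms on the plane is one-dimensional, so a substitution acts on it
  by a scalar, and that scalar is the determinant.\<close>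

lemma skew_part_congruence:
  fixes M S :: "'a::comm_ring_1 mat"
  assumes "M \<in> carrier_mat 2 2" "S \<in> carrier_mat 2 2"
  defines "N \<equiv> transpose_mat S * M * S"
  shows "N $$ (0,1) - N $$ (1,0) = det S * (M $$ (0,1) - M $$ (1,0))"
proof -
  note entry = congruence_mat2_entry[OF assms(1,2), folded N_def]
  show ?thesis
    by (simp add: entry det_mat2[OF assms(2)]) (simp add: algebra_simps)
qed

lemma not_symmetric_in_Xi_2:
  fixes M :: "'a::field mat"
  assumes M: "M \<in> carrier_mat 2 2" and "\<not> symmetric_mat M"
  shows "M \<in> Xi 2"
proof -
  have skew: "M $$ (0,1) - M $$ (1,0) \<noteq> 0"
    using assms by (simp add: symmetric_mat2_iff)
  have "det S = 1" if "S \<in> carrier_mat 2 2" "transpose_mat S * M * S = M" for S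
    using skew_part_congruence[OF M that(1)] skew that(2) by simp
  then show ?thesis
    using M unfolding Xi_def by blast
qed

text \<open>The orthogonal reflection along a vector \<open>v\<close> with \<open>q(v) \<noteq> 0\<close> sends \<open>w\<close> to
  \<open>w - 2 b(v,w) / q(v) v\<close>. The first two matrices in the proof are this map for the two basis
  vectors. If both are isotropic, the quadratic form is \<open>2 b x y\<close>, and exchanging \<open>x\<close> and \<open>y\<close>
  preserves it.\<close>

lemma symmetric_mat2_reflection:
  fixes M :: "'a::field mat"
  assumes M: "M \<in> carrier_mat 2 2" and sym: "symmetric_mat M"
  obtains S where "S \<in> carrier_mat 2 2" "transpose_mat S * M * S = M" "det S = - 1"
proof -
  define a b d where "a = M $$ (0,0)" and "b = M $$ (0,1)" and "d = M $$ (1,1)"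
  have b': "M $$ (1,0) = b"
    using M sym by (simp add: b_def symmetric_mat2_iff)
  note entries = a_def[symmetric] b_def[symmetric] d_def[symmetric] b'
  define R :: "'a \<Rightarrow> 'a \<Rightarrow> 'a \<Rightarrow> 'a \<Rightarrow> 'a mat"
    where "R = (\<lambda>p q r s. mat 2 2 (\<lambda>(i,j). if i = 0 then if j = 0 then p else q
                                              else if j = 0 then r else s))"
  have R: "R p q r s \<in> carrier_mat 2 2" for p q r s
    by (simp add: R_def)
  have R_entries: "R p q r s $$ (0,0) = p" "R p q r s $$ (0,1) = q"
      "R p q r s $$ (1,0) = r" "R p q r s $$ (1,1) = s" for p q r s
    by (simp_all add: R_def)
  have RMR: "transpose_mat (R p q r s) * M * R p q r s = M \<longleftrightarrow>
      p * a * p + p * b * r + r * b * p + r * d * r = a \<and>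
      p * a * q + p * b * s + r * b * q + r * d * s = b \<and>
      q * a * p + q * b * r + s * b * p + s * d * r = b \<and>
      q * a * q + q * b * s + s * b * q + s * d * s = d" for p q r s
  proof -
    have C: "transpose_mat (R p q r s) * M * R p q r s \<in> carrier_mat 2 2"
      by (intro mult_carrier_mat[where n = 2] transpose_carrier_mat M R) (simp add: R)
    have lt: "(0::nat) < 2" "(1::nat) < 2"
      by simp_all
    show ?thesis
      unfolding mat2_eq_iff[OF C M] congruence_mat2_entry[OF M R lt(1) lt(1)]
        congruence_mat2_entry[OF M R lt(1) lt(2)] congruence_mat2_entry[OF M R lt(2) lt(1)]
        congruence_mat2_entry[OF M R lt(2) lt(2)] R_entries entries
      by simp
  qed
  have detR: "det (R p q r s) = p * s - q * r" for p q r s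
    by (simp only: det_mat2[OF R] R_entries)
  consider "a \<noteq> 0" | "d \<noteq> 0" | "a = 0" "d = 0"
    by blast
  then show thesis
  proof cases
    case 1
    show thesis
      by (rule that[of "R (- 1) (- 2 * b / a) 0 1"])
        (use 1 in \<open>auto simp: R RMR detR field_simps\<close>)
  next
    case 2
    show thesis
      by (rule that[of "R 1 0 (- 2 * b / d) (- 1)"])
        (use 2 in \<open>auto simp: R RMR detR field_simps\<close>)
  next
    case 3
    show thesis
      by (rule that[of "R 0 1 1 0"]) (use 3 in \<open>auto simp: R RMR detR\<close>)
  qed
qed

theorem corollary1:
  assumes "CHAR('a::field) \<noteq> 2"
  shows "(\<forall>n. odd n \<longrightarrow> (Xi n :: 'a mat set) = {}) \<and>
         (\<forall>M \<in> carrier_mat 2 2. (M :: 'a mat) \<in> Xi 2 \<longleftrightarrow> \<not> symmetric_mat M)"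
proof (intro conjI allI impI ballI iffI)
  show "(Xi n :: 'a mat set) = {}" if "odd n" for n
    using assms that by (rule Xi_odd_empty)
  show "\<not> symmetric_mat M" if "M \<in> carrier_mat 2 2" "M \<in> Xi 2" for M :: "'a mat"
    using symmetric_mat2_reflection[OF that(1)] not_in_XiI[OF _ _ _ assms] that(2) by metis
  show "M \<in> Xi 2" if "M \<in> carrier_mat 2 2" "\<not> symmetric_mat M" for M :: "'a mat"
    using that by (rule not_symmetric_in_Xi_2)
qed

end
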